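(* Let $X,Y$ be Banach spaces. (i) Suppose that $Y$ is uniformly smooth and let $T\in\mathcal{L}(X,Y)$. If $T\in\mathcal{A}_{\|\cdot\|}(X,Y)$, then $T^*\in\mathcal{A}_{\|\cdot\|}(Y^*,X^* )$. (ii) Suppose that $X$ is uniformly convex and let $T\in\mathcal{L}(X,Y)$. If $T^*\in\mathcal{A}_{\|\cdot\|}(Y^*,X^* )$, then $T\in\mathcal{A}_{\|\cdot\|}(X,Y)$. (iii) Suppose that $X$ is reflexive and let $T\in\mathcal{L}(X)$. Then $T\in\mathcal{A}_{\mathrm{nu}}(X)$ if and only if $T^*\in\mathcal{A}_{\mathrm{nu}}(X^* )$.
   Context: Banach spaces are over $\mathbb{K}=\mathbb{R}$ or $\mathbb{C}$; $S_X$ is the unit sphere of $X$, $X^*$ the topological dual, $\mathcal{L}(X,Y)$ the bounded linear operators from $X$ to $Y$, $\mathcal{L}(X)=\mathcal{L}(X,X)$, $T^*$ is the (Banach space) adjoint of $T$, and $\langle x^*,x\rangle=x^*(x)$. An operator $T\in\mathcal{L}(X,Y)$ attains its norm if $\|T(x_0)\|=\|T\|$ for some $x_0\in S_X$. Let $\Pi(X)=\{(x,x^* )\in S_X\times S_{X^*}:\langle x^*,x\rangle=1\}$ and, for $T\in\mathcal{L}(X)$, $\nu(T)=\sup\{|\langle x^*,T(x)\rangle|:(x,x^* )\in\Pi(X)\}$; $T$ attains its numerical radius if this supremum is attained. $\mathcal{A}_{\|\cdot\|}(X,Y)$ is the set of all norm-attaining $T\in\mathcal{L}(X,Y)$ with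 $\|T\|=1$ such that for every $\varepsilon>0$ there is $\eta(\varepsilon,T)>0$ such that whenever $x\in S_X$ satisfies $\|T(x)\|>1-\eta(\varepsilon,T)$, there is $x_0\in S_X$ with $\|T(x_0)\|=1$ and $\|x_0-x\|<\varepsilon$. $\mathcal{A}_{\mathrm{nu}}(X)$ is the set of all numerical radius attaining $T\in\mathcal{L}(X)$ with $\nu(T)=1$ such that for every $\varepsilon>0$ there is $\eta(\varepsilon,T)>0$ such that whenever $(x,x^* )\in\Pi(X)$ satisfies $|\langle x^*,T(x)\rangle|>1-\eta(\varepsilon,T)$, there is $(x_0,x_0^* )\in\Pi(X)$ with $|\langle x_0^*,T(x_0)\rangle|=1$, $\|x_0-x\|<\varepsilon$ and $\|x_0^*-x^*\|<\varepsilon$. *)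

theory Defs
  imports "HOL-Analysis.Analysis"
begin

section \<open>Complex normed spaces\<close>

text \<open>The libraries provide real Banach spaces (class \<open>banach\<close>) only. A complex normed space is a
  real one with a compatible multiplication by complex scalars, for which the norm is homogeneous.\<close>

class complex_normed_vector = real_normed_vector +
  fixes scaleC :: "complex \<Rightarrow> 'a \<Rightarrow> 'a" (infixr \<open>*\<^sub>C\<close> 75)
  assumes scaleC_add_right: "c *\<^sub>C (x + y) = c *\<^sub>C x + c *\<^sub>C y"
    and scaleC_add_left: "(c + d) *\<^sub>C x = c *\<^sub>C x + d *\<^sub>C x"
    and scaleC_scaleC: "c *\<^sub>C d *\<^sub>C x = (c * d) *\<^sub>C x"
    and scaleC_one: "1 *\<^sub>C x = x"
    and scaleR_scaleC: "r *\<^sub>R x = complex_of_real r *\<^sub>C x"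
    and norm_scaleC: "norm (c *\<^sub>C x) = cmod c * norm x"

class complex_banach = complex_normed_vector + complete_space

subclass (in complex_banach) banach ..

instantiation complex :: complex_banach
begin

definition scaleC_complex :: "complex \<Rightarrow> complex \<Rightarrow> complex"
  where "scaleC_complex c z = c * z"

instance
  by standard (simp_all add: scaleC_complex_def algebra_simps norm_mult scaleR_conv_of_real)

end

definition bounded_clinear :: "('a::complex_normed_vector \<Rightarrow> 'b::complex_normed_vector) \<Rightarrow> bool"
  where "bounded_clinear f \<longleftrightarrow>
    (\<forall>x y. f (x + y) = f x + f y) \<and> (\<forall>c x. f (c *\<^sub>C x) = c *\<^sub>C f x) \<and>
    (\<exists>K. \<forall>x. norm (f x) \<le> norm x * K)"

lemma bounded_clinear_iff:
  "bounded_clinear f \<longleftrightarrow> bounded_linear f \<and> (\<forall>c x. f (c *\<^sub>C x) = c *\<^sub>C f x)"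
  unfolding bounded_clinear_def bounded_linear_def bounded_linear_axioms_def
  by (auto simp: scaleR_scaleC linear_iff)

lemma bounded_clinear_imp_bounded_linear: "bounded_clinear f \<Longrightarrow> bounded_linear f"
  by (simp add: bounded_clinear_iff)

lemma scaleC_zero_right [simp]: "c *\<^sub>C (0::'a::complex_normed_vector) = 0"
  by (metis add_cancel_right_right scaleC_add_right)

lemma scaleC_zero_left: "0 *\<^sub>C (x::'a::complex_normed_vector) = 0"
  by (metis norm_scaleC mult_zero_left norm_eq_zero norm_zero)

lemma bounded_linear_scaleC_right:
  "bounded_linear (\<lambda>x. c *\<^sub>C (x::'a::complex_normed_vector))"
  by (rule bounded_linear_intro[where K = "cmod c"])
    (simp_all add: scaleC_add_right scaleR_scaleC scaleC_scaleC norm_scaleC mult.commute)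

lemma onorm_scaleC:
  fixes f :: "'a::real_normed_vector \<Rightarrow> 'b::complex_normed_vector"
  assumes "bounded_linear f"
  shows "onorm (\<lambda>x. c *\<^sub>C f x) = cmod c * onorm f"
proof -
  have le: "onorm (\<lambda>x. d *\<^sub>C g x) \<le> cmod d * onorm g" if "bounded_linear g"
    for d and g :: "'a \<Rightarrow> 'b"
    using onorm[OF that] onorm_pos_le[OF that]
    by (intro onorm_bound) (auto simp: norm_scaleC mult.assoc intro!: mult_left_mono)
  show ?thesis
  proof (cases "c = 0")
    case True
    then have "(\<lambda>x. c *\<^sub>C f x) = (\<lambda>x. 0)"
      by (simp add: scaleC_zero_left)
    then show ?thesis using True by (simp add: onorm_zero)
  next
    case False
    have "bounded_linear (\<lambda>x. c *\<^sub>C f x)"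
      using bounded_linear_compose[OF bounded_linear_scaleC_right assms] .
    from le[OF this, of "inverse c"] have "onorm f \<le> inverse (cmod c) * onorm (\<lambda>x. c *\<^sub>C f x)"
      using False by (simp add: scaleC_scaleC scaleC_one norm_inverse)
    then have "cmod c * onorm f \<le> onorm (\<lambda>x. c *\<^sub>C f x)"
      using False by (simp add: field_simps)
    then show ?thesis using le[OF assms, of c] by (rule antisym[rotated])
  qed
qed


section \<open>Bounded complex-linear operators\<close>

text \<open>This follows the library's type of bounded real-linear operators; the norm is again the
  operator norm.\<close>

typedef (overloaded) ('a, 'b) cblinfun (\<open>(_ \<Rightarrow>\<^sub>C\<^sub>L /_)\<close> [22, 21] 21) =
    "{f :: 'a::complex_normed_vector \<Rightarrow> 'b::complex_normed_vector. bounded_clinear f}"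
  morphisms cblinfun_apply CBlinfun
  by (rule exI[where x = "\<lambda>_. 0"]) (simp add: bounded_clinear_iff)

declare [[coercion "cblinfun_apply :: ('a::complex_normed_vector \<Rightarrow>\<^sub>C\<^sub>L 'b::complex_normed_vector) \<Rightarrow> 'a \<Rightarrow> 'b"]]

setup_lifting type_definition_cblinfun

instantiation cblinfun :: (complex_normed_vector, complex_normed_vector) complex_normed_vector
begin

lift_definition norm_cblinfun :: "'a \<Rightarrow>\<^sub>C\<^sub>L 'b \<Rightarrow> real" is onorm .

lift_definition zero_cblinfun :: "'a \<Rightarrow>\<^sub>C\<^sub>L 'b" is "\<lambda>x. 0"
  by (simp add: bounded_clinear_iff)

lift_definition plus_cblinfun :: "'a \<Rightarrow>\<^sub>C\<^sub>L 'b \<Rightarrow> 'a \<Rightarrow>\<^sub>C\<^sub>L 'b \<Rightarrow> 'a \<Rightarrow>\<^sub>C\<^sub>L 'b" is "\<lambda>f g x. f x + g x"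
  by (simp add: bounded_clinear_iff bounded_linear_add scaleC_add_right)

lift_definition scaleC_cblinfun :: "complex \<Rightarrow> 'a \<Rightarrow>\<^sub>C\<^sub>L 'b \<Rightarrow> 'a \<Rightarrow>\<^sub>C\<^sub>L 'b" is "\<lambda>c f x. c *\<^sub>C f x"
  by (auto simp: bounded_clinear_iff scaleC_scaleC mult.commute
      intro: bounded_linear_compose[OF bounded_linear_scaleC_right])

definition scaleR_cblinfun :: "real \<Rightarrow> 'a \<Rightarrow>\<^sub>C\<^sub>L 'b \<Rightarrow> 'a \<Rightarrow>\<^sub>C\<^sub>L 'b"
  where "scaleR_cblinfun r f = complex_of_real r *\<^sub>C f"

definition uminus_cblinfun :: "'a \<Rightarrow>\<^sub>C\<^sub>L 'b \<Rightarrow> 'a \<Rightarrow>\<^sub>C\<^sub>L 'b"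
  where "uminus_cblinfun f = (- 1) *\<^sub>C f"

definition minus_cblinfun :: "'a \<Rightarrow>\<^sub>C\<^sub>L 'b \<Rightarrow> 'a \<Rightarrow>\<^sub>C\<^sub>L 'b \<Rightarrow> 'a \<Rightarrow>\<^sub>C\<^sub>L 'b"
  where "minus_cblinfun f g = f + - g"

definition dist_cblinfun :: "'a \<Rightarrow>\<^sub>C\<^sub>L 'b \<Rightarrow> 'a \<Rightarrow>\<^sub>C\<^sub>L 'b \<Rightarrow> real"
  where "dist_cblinfun f g = norm (f - g)"

definition sgn_cblinfun :: "'a \<Rightarrow>\<^sub>C\<^sub>L 'b \<Rightarrow> 'a \<Rightarrow>\<^sub>C\<^sub>L 'b"
  where "sgn_cblinfun f = inverse (norm f) *\<^sub>R f"

definition [code del]: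
  "(uniformity :: (('a \<Rightarrow>\<^sub>C\<^sub>L 'b) \<times> ('a \<Rightarrow>\<^sub>C\<^sub>L 'b)) filter) =
    (INF e\<in>{0<..}. principal {(x, y). dist x y < e})"

definition open_cblinfun :: "('a \<Rightarrow>\<^sub>C\<^sub>L 'b) set \<Rightarrow> bool"
  where [code del]: "open_cblinfun S = (\<forall>x\<in>S. \<forall>\<^sub>F (x', y) in uniformity. x' = x \<longrightarrow> y \<in> S)"

instance
proof
  fix f g h :: "'a \<Rightarrow>\<^sub>C\<^sub>L 'b" and c d :: complex and r s :: real
  show "f + g + h = f + (g + h)" "f + g = g + f" "0 + f = f"
    by (transfer, simp add: add_ac)+
  show "c *\<^sub>C (f + g) = c *\<^sub>C f + c *\<^sub>C g" "(c + d) *\<^sub>C f = c *\<^sub>C f + d *\<^sub>C f"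
    "c *\<^sub>C d *\<^sub>C f = (c * d) *\<^sub>C f" "1 *\<^sub>C f = f"
    by (transfer, simp add: scaleC_add_right scaleC_add_left scaleC_scaleC scaleC_one)+
  show "norm (c *\<^sub>C f) = cmod c * norm f"
    by transfer (simp add: bounded_clinear_iff onorm_scaleC)
  show norm0: "norm f = 0 \<longleftrightarrow> f = 0"
    by transfer (simp add: bounded_clinear_iff onorm_eq_0 fun_eq_iff)
  show "norm (f + g) \<le> norm f + norm g"
    by transfer (simp add: bounded_clinear_iff onorm_triangle)
  show "r *\<^sub>R f = complex_of_real r *\<^sub>C f"
    by (simp add: scaleR_cblinfun_def)
  show "f - g = f + - g"
    by (simp add: minus_cblinfun_def)
  have "0 *\<^sub>C f = 0"
    by transfer (simp add: scaleC_zero_left)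
  moreover have "- f + f = (- 1 + 1) *\<^sub>C f"
    unfolding uminus_cblinfun_def
    by transfer (simp only: scaleC_add_left scaleC_one)
  ultimately show "- f + f = 0"
    by simp
  show "r *\<^sub>R (f + g) = r *\<^sub>R f + r *\<^sub>R g" "(r + s) *\<^sub>R f = r *\<^sub>R f + s *\<^sub>R f"
    "r *\<^sub>R s *\<^sub>R f = (r * s) *\<^sub>R f" "1 *\<^sub>R f = f"
    unfolding scaleR_cblinfun_def
    by (transfer, simp add: scaleC_add_right scaleC_add_left scaleC_scaleC scaleC_one)+
  show "norm (r *\<^sub>R f) = \<bar>r\<bar> * norm f"
    unfolding scaleR_cblinfun_def by transfer (simp add: bounded_clinear_iff onorm_scaleC)
qed (simp_all add: dist_cblinfun_def sgn_cblinfun_def uniformity_cblinfun_def open_cblinfun_def)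

end

lemma norm_cblinfun: "norm (cblinfun_apply f x) \<le> norm f * norm x"
  by transfer (simp add: bounded_clinear_iff onorm)

lemma norm_cblinfun_bound:
  "0 \<le> b \<Longrightarrow> (\<And>x. norm (cblinfun_apply f x) \<le> b * norm x) \<Longrightarrow> norm f \<le> b"
  by transfer (rule onorm_bound)


section \<open>Geometry of the norm\<close>

definition uniformly_convex :: "'a::real_normed_vector itself \<Rightarrow> bool"
  where "uniformly_convex (_ :: 'a itself) \<longleftrightarrow>
    (\<forall>\<epsilon>>0. \<exists>\<delta>>0. \<forall>x\<in>sphere (0::'a) 1. \<forall>y\<in>sphere 0 1.
      norm (x - y) \<ge> \<epsilon> \<longrightarrow> norm ((x + y) /\<^sub>R 2) \<le> 1 - \<delta>)"

text \<open>This is \<open>\<rho>(t) / t \<rightarrow> 0\<close> as \<open>t \<rightarrow> 0+\<close> for the modulus of smoothness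
  \<open>\<rho>(t) = sup {(\<parallel>x + y\<parallel> + \<parallel>x - y\<parallel>) / 2 - 1 | \<parallel>x\<parallel> = 1, \<parallel>y\<parallel> = t}\<close>, written out
  with the factor 2 absorbed into \<open>\<epsilon>\<close>.\<close>

definition uniformly_smooth :: "'a::real_normed_vector itself \<Rightarrow> bool"
  where "uniformly_smooth (_ :: 'a itself) \<longleftrightarrow>
    (\<forall>\<epsilon>>0. \<exists>\<delta>>0. \<forall>x\<in>sphere (0::'a) 1. \<forall>y. norm y \<le> \<delta> \<longrightarrow>
      norm (x + y) + norm (x - y) \<le> 2 + \<epsilon> * norm y)"


section \<open>Real scalars\<close>

lift_definition dual_operator ::
    "('a::real_normed_vector \<Rightarrow>\<^sub>L 'b::real_normed_vector) \<Rightarrow> ('b \<Rightarrow>\<^sub>L real) \<Rightarrow>\<^sub>L ('a \<Rightarrow>\<^sub>L real)"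
  is "\<lambda>T y'. y' o\<^sub>L T"
  by (rule bounded_bilinear.bounded_linear_left[OF bounded_bilinear_blinfun_compose])

lift_definition bidual_embedding ::
    "'a::real_normed_vector \<Rightarrow> (('a \<Rightarrow>\<^sub>L real) \<Rightarrow>\<^sub>L real)"
  is "\<lambda>x x'. blinfun_apply x' x"
  by (rule blinfun.bounded_linear_left)

definition reflexive_space :: "'a::real_normed_vector itself \<Rightarrow> bool"
  where "reflexive_space (_ :: 'a itself) \<longleftrightarrow>
    surj (bidual_embedding :: 'a \<Rightarrow> ('a \<Rightarrow>\<^sub>L real) \<Rightarrow>\<^sub>L real)"

definition attains_norm :: "('a::real_normed_vector \<Rightarrow>\<^sub>L 'b::real_normed_vector) \<Rightarrow> bool"
  where "attains_norm T \<longleftrightarrow> (\<exists>x\<^sub>0\<in>sphere 0 1. norm (T x\<^sub>0) = norm T)"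

definition A_norm :: "('a::real_normed_vector \<Rightarrow>\<^sub>L 'b::real_normed_vector) set"
  where "A_norm = {T. attains_norm T \<and> norm T = 1 \<and>
    (\<forall>\<epsilon>>0. \<exists>\<eta>>0. \<forall>x\<in>sphere 0 1. norm (T x) > 1 - \<eta> \<longrightarrow>
      (\<exists>x\<^sub>0\<in>sphere 0 1. norm (T x\<^sub>0) = 1 \<and> norm (x\<^sub>0 - x) < \<epsilon>))}"

text \<open>The set \<open>\<Pi>(X)\<close>. It is empty only for the zero space, where the supremum below is
  unspecified but attainment fails.\<close>

definition states :: "('a::real_normed_vector \<times> ('a \<Rightarrow>\<^sub>L real)) set"
  where "states = {(x, x'). x \<in> sphere 0 1 \<and> x' \<in> sphere 0 1 \<and> blinfun_apply x' x = 1}"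

definition numerical_radius :: "('a::real_normed_vector \<Rightarrow>\<^sub>L 'a) \<Rightarrow> real"
  where "numerical_radius T = (SUP (x, x')\<in>states. norm (blinfun_apply x' (T x)))"

definition attains_numerical_radius :: "('a::real_normed_vector \<Rightarrow>\<^sub>L 'a) \<Rightarrow> bool"
  where "attains_numerical_radius T \<longleftrightarrow> (\<exists>(x, x')\<in>states. norm (blinfun_apply x' (T x)) = numerical_radius T)"

definition A_nu :: "('a::real_normed_vector \<Rightarrow>\<^sub>L 'a) set"
  where "A_nu = {T. attains_numerical_radius T \<and> numerical_radius T = 1 \<and>
    (\<forall>\<epsilon>>0. \<exists>\<eta>>0. \<forall>(x, x')\<in>states. norm (blinfun_apply x' (T x)) > 1 - \<eta> \<longrightarrow>
      (\<exists>(x\<^sub>0, x\<^sub>0')\<in>states. norm (blinfun_apply x\<^sub>0' (T x\<^sub>0)) = 1 \<and>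
        norm (x\<^sub>0 - x) < \<epsilon> \<and> norm (x\<^sub>0' - x') < \<epsilon>))}"


section \<open>Complex scalars\<close>

lift_definition cblinfun_compose ::
    "('b::complex_normed_vector \<Rightarrow>\<^sub>C\<^sub>L 'c::complex_normed_vector) \<Rightarrow>
      ('a::complex_normed_vector \<Rightarrow>\<^sub>C\<^sub>L 'b) \<Rightarrow> ('a \<Rightarrow>\<^sub>C\<^sub>L 'c)"
  is "\<lambda>f g x. f (g x)"
  by (auto simp: bounded_clinear_iff intro: bounded_linear_compose)

lift_definition cdual_operator ::
    "('a::complex_normed_vector \<Rightarrow>\<^sub>C\<^sub>L 'b::complex_normed_vector) \<Rightarrow>
      ('b \<Rightarrow>\<^sub>C\<^sub>L complex) \<Rightarrow>\<^sub>C\<^sub>L ('a \<Rightarrow>\<^sub>C\<^sub>L complex)"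
  is "\<lambda>T y'. cblinfun_compose y' T"
  unfolding bounded_clinear_def
proof (intro conjI allI exI)
  fix T :: "'a \<Rightarrow>\<^sub>C\<^sub>L 'b" and f g :: "'b \<Rightarrow>\<^sub>C\<^sub>L complex" and c
  show "cblinfun_compose (f + g) T = cblinfun_compose f T + cblinfun_compose g T"
    "cblinfun_compose (c *\<^sub>C f) T = c *\<^sub>C cblinfun_compose f T"
    by (transfer, simp)+
  show "norm (cblinfun_compose f T) \<le> norm f * norm T"
    by transfer (auto simp: bounded_clinear_iff comp_def dest: onorm_compose)
qed

lift_definition cbidual_embedding ::
    "'a::complex_normed_vector \<Rightarrow> (('a \<Rightarrow>\<^sub>C\<^sub>L complex) \<Rightarrow>\<^sub>C\<^sub>L complex)"
  is "\<lambda>x x'. cblinfun_apply x' x"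
  unfolding bounded_clinear_def
proof (intro conjI allI exI)
  fix x :: 'a and f g :: "'a \<Rightarrow>\<^sub>C\<^sub>L complex" and c
  show "cblinfun_apply (f + g) x = f x + g x" "cblinfun_apply (c *\<^sub>C f) x = c *\<^sub>C f x"
    by (transfer, simp)+
  show "norm (f x) \<le> norm f * norm x"
    by (rule norm_cblinfun)
qed

definition creflexive_space :: "'a::complex_normed_vector itself \<Rightarrow> bool"
  where "creflexive_space (_ :: 'a itself) \<longleftrightarrow>
    surj (cbidual_embedding :: 'a \<Rightarrow> ('a \<Rightarrow>\<^sub>C\<^sub>L complex) \<Rightarrow>\<^sub>C\<^sub>L complex)"

definition cattains_norm :: "('a::complex_normed_vector \<Rightarrow>\<^sub>C\<^sub>L 'b::complex_normed_vector) \<Rightarrow> bool"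
  where "cattains_norm T \<longleftrightarrow> (\<exists>x\<^sub>0\<in>sphere 0 1. norm (T x\<^sub>0) = norm T)"

definition cA_norm :: "('a::complex_normed_vector \<Rightarrow>\<^sub>C\<^sub>L 'b::complex_normed_vector) set"
  where "cA_norm = {T. cattains_norm T \<and> norm T = 1 \<and>
    (\<forall>\<epsilon>>0. \<exists>\<eta>>0. \<forall>x\<in>sphere 0 1. norm (T x) > 1 - \<eta> \<longrightarrow>
      (\<exists>x\<^sub>0\<in>sphere 0 1. norm (T x\<^sub>0) = 1 \<and> norm (x\<^sub>0 - x) < \<epsilon>))}"

definition cstates :: "('a::complex_normed_vector \<times> ('a \<Rightarrow>\<^sub>C\<^sub>L complex)) set"
  where "cstates = {(x, x'). x \<in> sphere 0 1 \<and> x' \<in> sphere 0 1 \<and> cblinfun_apply x' x = 1}"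

definition cnumerical_radius :: "('a::complex_normed_vector \<Rightarrow>\<^sub>C\<^sub>L 'a) \<Rightarrow> real"
  where "cnumerical_radius T = (SUP (x, x')\<in>cstates. norm (cblinfun_apply x' (T x)))"

definition cattains_numerical_radius :: "('a::complex_normed_vector \<Rightarrow>\<^sub>C\<^sub>L 'a) \<Rightarrow> bool"
  where "cattains_numerical_radius T \<longleftrightarrow>
    (\<exists>(x, x')\<in>cstates. norm (cblinfun_apply x' (T x)) = cnumerical_radius T)"

definition cA_nu :: "('a::complex_normed_vector \<Rightarrow>\<^sub>C\<^sub>L 'a) set"
  where "cA_nu = {T. cattains_numerical_radius T \<and> cnumerical_radius T = 1 \<and>
    (\<forall>\<epsilon>>0. \<exists>\<eta>>0. \<forall>(x, x')\<in>cstates. norm (cblinfun_apply x' (T x)) > 1 - \<eta> \<longrightarrow>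
      (\<exists>(x\<^sub>0, x\<^sub>0')\<in>cstates. norm (cblinfun_apply x\<^sub>0' (T x\<^sub>0)) = 1 \<and>
        norm (x\<^sub>0 - x) < \<epsilon> \<and> norm (x\<^sub>0' - x') < \<epsilon>))}"

end

theory Submission
  imports Defs
begin

text \<open>For (i), let \<open>y'\<close> almost attain the norm of the adjoint \<open>T'\<close>, say \<open>y' (T x)\<close> is almost 1. By
  hypothesis \<open>x\<close> is close to a point \<open>u\<close> with \<open>\<parallel>T u\<parallel> = 1\<close>, and \<open>T'\<close> attains its norm at any functional \<open>z'\<close>
  supporting \<open>T u\<close>. As \<open>y'\<close> and \<open>z'\<close> both almost support \<open>T u\<close>, uniform smoothness (Smulian's estimate)
  makes them close. For (ii), let \<open>y'\<close> support \<open>T x\<close> for an \<open>x\<close> almost attaining the norm of \<open>T\<close>, and let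
  \<open>z'\<close> be close to it with \<open>\<parallel>T' z'\<parallel> = 1\<close>. By uniform convexity and completeness \<open>T' z'\<close> attains its norm at
  some \<open>u\<close>, where \<open>T\<close> attains its norm as well, and \<open>u\<close> is close to \<open>x\<close> because \<open>T' z'\<close> is almost 1 at
  \<open>x\<close>. For (iii), reflexivity makes \<open>(x, x') \<mapsto> (x', J x)\<close>, with \<open>J\<close> the canonical embedding, an isometric
  bijection between the states of a space and those of its dual, and it preserves numerical values.
  Complex (i) and (ii) follow from the real case, since \<open>f \<mapsto> Re f\<close> is a real-linear isometry from the
  complex dual onto the real one.\<close>

section \<open>The Hahn--Banach theorem\<close>

text \<open>Homogeneity is asked for only as an inequality, which is what infima deliver directly;
  \<open>sublinear_scale\<close> recovers equality.\<close>

definition sublinear :: "('a::real_vector \<Rightarrow> real) \<Rightarrow> bool"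
  where "sublinear p \<longleftrightarrow>
    (\<forall>x y. p (x + y) \<le> p x + p y) \<and> (\<forall>t\<ge>0. \<forall>x. p (t *\<^sub>R x) \<le> t * p x)"

lemma sublinear_add: "sublinear p \<Longrightarrow> p (x + y) \<le> p x + p y"
  by (simp add: sublinear_def)

lemma sublinear_scale_le: "sublinear p \<Longrightarrow> 0 \<le> t \<Longrightarrow> p (t *\<^sub>R x) \<le> t * p x"
  by (simp add: sublinear_def)

lemma sublinear_zero:
  assumes "sublinear p"
  shows "p 0 = 0"
  using sublinear_scale_le[OF assms, of 0 0] sublinear_add[OF assms, of 0 0] by simp

lemma sublinear_scale:
  assumes "sublinear p" "0 \<le> t"
  shows "p (t *\<^sub>R x) = t * p x"
proof (cases "t = 0")
  case True
  then show ?thesis by (simp add: sublinear_zero[OF assms(1)])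
next
  case False
  then have "p x \<le> inverse t * p (t *\<^sub>R x)"
    using sublinear_scale_le[OF assms(1), of "inverse t" "t *\<^sub>R x"] assms(2) by simp
  then have "t * p x \<le> p (t *\<^sub>R x)"
    using False assms(2) by (simp add: field_simps)
  then show ?thesis
    using sublinear_scale_le[OF assms, of x] by simp
qed

lemma sublinear_ge_uminus: "sublinear p \<Longrightarrow> - p (- x) \<le> p x"
  using sublinear_add[of p x "- x"] by (simp add: sublinear_zero)

text \<open>Oddness turns the upper bounds into lower ones: writing \<open>x\<close> as
  \<open>(x + y) + (- y)\<close> reverses subadditivity, and negative scalars reduce to positive
  ones.\<close>

lemma sublinear_odd_imp_linear:
  assumes p: "sublinear p" and odd: "\<And>x. p (- x) \<le> - p x"
  shows "linear p"
proof
  have uminus: "p (- x) = - p x" for x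
    using odd[of x] sublinear_ge_uminus[OF p, of x] by simp
  show "p (x + y) = p x + p y" for x y
    using sublinear_add[OF p, of x y] sublinear_add[OF p, of "x + y" "- y"] by (simp add: uminus)
  show "p (r *\<^sub>R x) = r *\<^sub>R p x" for r x
  proof (cases "0 \<le> r")
    case False
    then have "p (- (r *\<^sub>R x)) = - r * p x"
      using sublinear_scale[OF p, of "- r" x] by simp
    then show ?thesis by (simp add: uminus)
  qed (simp add: sublinear_scale[OF p])
qed

lemma sublinear_norm: "sublinear norm"
  by (simp add: sublinear_def norm_triangle_ineq)

text \<open>Unless \<open>p\<close> is already odd at \<open>y\<close>, the functional
  \<open>q\<close> differs from \<open>p\<close> and lies below it, so a minimal \<open>p\<close>
  must be odd. The cases \<open>t = 0\<close> and \<open>t = 1\<close> of the infimum give the last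
  two claims.\<close>

lemma sublinear_reduce:
  assumes p: "sublinear p"
  obtains q where "sublinear q" "q \<le> p" "q (- y) \<le> - p y"
proof -
  define q where "q x = (INF t\<in>{0..}. p (x + t *\<^sub>R y) - t * p y)" for x
  \<comment> \<open>This bound does not depend on \<open>t\<close>, so the infimum is
    finite.\<close>
  have below: "- p (- x) \<le> p (x + t *\<^sub>R y) - t * p y" if "0 \<le> t" for x t
    using sublinear_add[OF p, of "x + t *\<^sub>R y" "- x"] sublinear_scale[OF p that, of y] by simp
  have le: "q x \<le> p (x + t *\<^sub>R y) - t * p y" if "0 \<le> t" for x t
    unfolding q_def using that below by (intro cINF_lower bdd_belowI2[where m = "- p (- x)"]) auto
  have ge: "m \<le> q x" if "\<And>t. 0 \<le> t \<Longrightarrow> m \<le> p (x + t *\<^sub>R y) - t * p y" for m x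
    unfolding q_def using that by (intro cINF_greatest) auto
  have add: "q (x + z) \<le> q x + q z" for x z
  proof -
    \<comment> \<open>The parameter \<open>t + s\<close> at \<open>x + z\<close> serves both
      summands; the infima over \<open>t\<close> and \<open>s\<close> are then taken one after the
      other.\<close>
    have "q (x + z) - (p (z + s *\<^sub>R y) - s * p y) \<le> p (x + t *\<^sub>R y) - t * p y"
      if "0 \<le> s" "0 \<le> t" for s t
      using le[of "t + s" "x + z"] that sublinear_add[OF p, of "x + t *\<^sub>R y" "z + s *\<^sub>R y"]
      by (simp add: algebra_simps)
    then have "q (x + z) - (p (z + s *\<^sub>R y) - s * p y) \<le> q x" if "0 \<le> s" for s
      using that by (intro ge) auto
    then have "q (x + z) - q x \<le> q z"
      by (intro ge) (simp add: algebra_simps)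
    then show ?thesis by simp
  qed
  have le0: "q x \<le> p x" for x
    using le[of 0 x] by simp
  have scale: "q (s *\<^sub>R x) \<le> s * q x" if "0 \<le> s" for s x
  proof (cases "s = 0")
    case True
    then show ?thesis using le0[of 0] by (simp add: sublinear_zero[OF p])
  next
    case False
    with that have "0 < s" by simp
    have "q (s *\<^sub>R x) / s \<le> p (x + t *\<^sub>R y) - t * p y" if "0 \<le> t" for t
    proof -
      have "q (s *\<^sub>R x) \<le> p (s *\<^sub>R (x + t *\<^sub>R y)) - (s * t) * p y"
        using le[of "s * t" "s *\<^sub>R x"] that \<open>0 < s\<close> by (simp add: scaleR_add_right)
      also have "\<dots> = s * (p (x + t *\<^sub>R y) - t * p y)"
        using \<open>0 < s\<close> by (simp add: sublinear_scale[OF p] right_diff_distrib)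
      finally show ?thesis using \<open>0 < s\<close> by (simp add: field_simps)
    qed
    then have "q (s *\<^sub>R x) / s \<le> q x" by (rule ge)
    then show ?thesis using \<open>0 < s\<close> by (simp add: field_simps)
  qed
  show thesis
  proof
    show "sublinear q" using add scale by (simp add: sublinear_def)
    show "q \<le> p" using le0 by (simp add: le_fun_def)
    show "q (- y) \<le> - p y" using le[of 1 "- y"] by (simp add: sublinear_zero[OF p])
  qed
qed

text \<open>The pointwise infimum works: the common bound \<open>p\<close> keeps it finite, and
  subadditivity survives because any two members of a chain are comparable.\<close>

lemma sublinear_chain_lower_bound:
  assumes C: "C \<noteq> {}" "\<And>q. q \<in> C \<Longrightarrow> sublinear q \<and> q \<le> p"
    and chain: "\<And>q r. q \<in> C \<Longrightarrow> r \<in> C \<Longrightarrow> q \<le> r \<or> r \<le> q"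
  obtains u where "sublinear u" "u \<le> p" "\<And>q. q \<in> C \<Longrightarrow> u \<le> q"
proof -
  define u where "u x = (INF q\<in>C. q x)" for x
  have below: "- p (- x) \<le> q x" if "q \<in> C" for q x
    using sublinear_ge_uminus[of q x] C(2)[OF that] le_funD[of q p "- x"] by force
  have le: "u x \<le> q x" if "q \<in> C" for q x
    unfolding u_def using that below by (intro cINF_lower bdd_belowI2[where m = "- p (- x)"]) auto
  have ge: "m \<le> u x" if "\<And>q. q \<in> C \<Longrightarrow> m \<le> q x" for m x
    unfolding u_def using that C(1) by (intro cINF_greatest) auto
  have add: "u (x + y) \<le> u x + u y" for x y
  proof -
    have "u (x + y) - r y \<le> q x" if qr: "q \<in> C" "r \<in> C" for q r
    proof -
      \<comment> \<open>The smaller of \<open>q\<close> and \<open>r\<close> is usable at both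
        points at once.\<close>
      obtain s where s: "s \<in> C" "s x \<le> q x" "s y \<le> r y"
        using chain[OF qr] qr by (metis le_funD order_refl)
      then show ?thesis
        using le[OF s(1), of "x + y"] sublinear_add[of s x y] C(2)[OF s(1)] by linarith
    qed
    then have "u (x + y) - r y \<le> u x" if "r \<in> C" for r
      using that by (intro ge) auto
    then have "u (x + y) - u x \<le> u y"
      by (intro ge) (simp add: algebra_simps)
    then show ?thesis by simp
  qed
  have scale: "u (t *\<^sub>R x) \<le> t * u x" if "0 \<le> t" for t x
  proof (cases "t = 0")
    case True
    then show ?thesis using C le[of _ 0] by (auto simp: sublinear_zero dest!: ex_in_conv[THEN iffD2])
  next
    case False
    with that have "0 < t" by simp
    have "u (t *\<^sub>R x) / t \<le> q x" if "q \<in> C" for q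
      using le[OF that, of "t *\<^sub>R x"] C(2)[OF that] \<open>0 < t\<close>
      by (simp add: sublinear_scale field_simps)
    then have "u (t *\<^sub>R x) / t \<le> u x" by (rule ge)
    then show ?thesis using \<open>0 < t\<close> by (simp add: field_simps)
  qed
  show thesis
  proof
    show "sublinear u" using add scale by (simp add: sublinear_def)
    show "u \<le> q" if "q \<in> C" for q using le[OF that] by (simp add: le_fun_def)
    then show "u \<le> p" using C by (meson ex_in_conv order_trans)
  qed
qed

text \<open>A minimal sublinear functional is linear, since it cannot be reduced further.\<close>

lemma linear_below_sublinear:
  assumes p: "sublinear (p :: 'a::real_vector \<Rightarrow> real)"
  obtains f where "linear f" "f \<le> p"
proof -
  let ?A = "{q. sublinear q \<and> q \<le> p}"
  \<comment> \<open>The order is reversed, so that the maximal element from Zorn's lemma is a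
    minimal functional.\<close>
  have po: "partial_order_on ?A (relation_of (\<ge>) ?A)"
    by (rule partial_order_on_relation_ofI) auto
  have "\<exists>u\<in>?A. \<forall>q\<in>C. u \<le> q" if "C \<in> Chains (relation_of (\<ge>) ?A)" for C
  proof (cases "C = {}")
    case True
    then show ?thesis using p by auto
  next
    case False
    have C: "sublinear q \<and> q \<le> p" if "q \<in> C" for q
      using that \<open>C \<in> _\<close> by (auto simp: Chains_def relation_of_def)
    have chain: "q \<le> r \<or> r \<le> q" if "q \<in> C" "r \<in> C" for q r
      using that \<open>C \<in> _\<close> by (auto simp: Chains_def relation_of_def)
    obtain u where "sublinear u" "u \<le> p" "\<And>q. q \<in> C \<Longrightarrow> u \<le> q"
      using sublinear_chain_lower_bound[of C p] False C chain by blast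
    then show ?thesis by blast
  qed
  from predicate_Zorn[OF po this]
  obtain f where f: "sublinear f" "f \<le> p" and min: "\<And>q. sublinear q \<Longrightarrow> q \<le> p \<Longrightarrow> q \<le> f \<Longrightarrow> q = f"
    by auto
  have "f (- y) \<le> - f y" for y
  proof -
    obtain q where "sublinear q" "q \<le> f" "q (- y) \<le> - f y"
      using sublinear_reduce[OF f(1)] .
    with min[of q] f(2) show ?thesis by auto
  qed
  with f show thesis using that sublinear_odd_imp_linear by blast
qed

text \<open>Reducing at \<open>x\<close> first forces equality there: a linear \<open>f\<close>
  below \<open>q\<close> has \<open>- f x = f (- x) \<le> q (- x) \<le> - p x\<close>.\<close>

theorem Hahn_Banach_sublinear:
  assumes p: "sublinear (p :: 'a::real_vector \<Rightarrow> real)"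
  obtains f where "linear f" "f \<le> p" "f x = p x"
proof -
  obtain q where q: "sublinear q" "q \<le> p" "q (- x) \<le> - p x"
    using sublinear_reduce[OF p] .
  obtain f where f: "linear f" "f \<le> q"
    using linear_below_sublinear[OF q(1)] .
  have "f (- x) = - f x" using f(1) by (rule linear_neg)
  then have "p x \<le> f x" using le_funD[OF f(2), of "- x"] q(3) by simp
  with f q(2) that[of f] show thesis
    by (metis le_funD order_antisym order_trans)
qed

section \<open>Norming functionals\<close>

corollary norming_functional:
  fixes x :: "'a::real_normed_vector"
  obtains f :: "'a \<Rightarrow>\<^sub>L real" where "norm f \<le> 1" "f x = norm x"
proof -
  obtain g where g: "linear g" "g \<le> norm" "g x = norm x"
    using Hahn_Banach_sublinear[OF sublinear_norm] .
  have le: "\<bar>g y\<bar> \<le> norm y" for y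
    using le_funD[OF g(2), of y] le_funD[OF g(2), of "- y"] linear_neg[OF g(1), of y] by simp
  have "bounded_linear g"
    by (rule bounded_linear_intro[where K = 1])
      (use g(1) le in \<open>auto simp: linear_add linear_scale\<close>)
  then show thesis
    by (intro that[of "Blinfun g"] norm_blinfun_bound)
      (use g(3) le in \<open>simp_all add: bounded_linear_Blinfun_apply\<close>)
qed

corollary unit_norming_functional:
  fixes x :: "'a::real_normed_vector"
  assumes "x \<noteq> 0"
  obtains f :: "'a \<Rightarrow>\<^sub>L real" where "norm f = 1" "f x = norm x"
proof -
  obtain f :: "'a \<Rightarrow>\<^sub>L real" where f: "norm f \<le> 1" "f x = norm x"
    using norming_functional .
  have "norm x \<le> norm f * norm x"
    using norm_blinfun[of f x] f(2) by simp
  then have "1 \<le> norm f" using assms by simp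
  with f that show thesis by force
qed


section \<open>Duality\<close>

lemma dual_operator_apply [simp]: "dual_operator T y' x = y' (T x)"
  by transfer simp

lemma bidual_embedding_apply [simp]: "bidual_embedding x x' = x' x"
  by transfer simp

lemma blinfun_apply_le_norm:
  fixes f :: "'a::real_normed_vector \<Rightarrow>\<^sub>L 'b::real_normed_vector"
  shows "norm x \<le> 1 \<Longrightarrow> norm (f x) \<le> norm f"
  using norm_blinfun[of f x] mult_left_mono[of "norm x" 1 "norm f"] by simp

lemma functional_apply_le:
  fixes f :: "'a::real_normed_vector \<Rightarrow>\<^sub>L real"
  shows "norm f \<le> 1 \<Longrightarrow> f x \<le> norm x"
  using norm_blinfun[of f x] mult_right_mono[of "norm f" 1 "norm x"] by simp

lemma functional_near_norm:
  fixes f :: "'a::real_normed_vector \<Rightarrow>\<^sub>L real"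
  assumes "c < norm f" "0 \<le> c"
  obtains x where "norm x = 1" "c < f x"
proof -
  obtain z where z: "c * norm z < norm (f z)"
    using norm_blinfun_bound[OF assms(2), of f] assms(1) by (meson not_le)
  then have "z \<noteq> 0" by auto
  \<comment> \<open>The sign makes \<open>f x\<close> positive, so the absolute value
    disappears.\<close>
  define x where "x = (sgn (f z) / norm z) *\<^sub>R z"
  have "f z \<noteq> 0" using z assms(2) by (auto simp: mult_less_0_iff)
  then have "norm x = 1" "f x = norm (f z) / norm z"
    using \<open>z \<noteq> 0\<close> by (auto simp: x_def blinfun.scaleR_right abs_sgn_eq abs_sgn mult.commute)
  with z \<open>z \<noteq> 0\<close> that[of x] show thesis by (simp add: field_simps)
qed

lemma norm_dual_operator:
  fixes T :: "'a::real_normed_vector \<Rightarrow>\<^sub>L 'b::real_normed_vector"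
  shows "norm (dual_operator T) = norm T"
proof (rule antisym)
  show "norm (dual_operator T) \<le> norm T"
  proof (rule norm_blinfun_bound)
    fix y' :: "'b \<Rightarrow>\<^sub>L real"
    have "norm (y' (T x)) \<le> (norm T * norm y') * norm x" for x
      using norm_blinfun[of y' "T x"] mult_left_mono[OF norm_blinfun[of T x], of "norm y'"]
      by (simp add: mult_ac)
    then show "norm (dual_operator T y') \<le> norm T * norm y'"
      by (intro norm_blinfun_bound) auto
  qed simp
  show "norm T \<le> norm (dual_operator T)"
  proof (rule norm_blinfun_bound)
    fix x
    obtain y' :: "'b \<Rightarrow>\<^sub>L real" where y': "norm y' \<le> 1" "y' (T x) = norm (T x)"
      using norming_functional .
    have "norm (T x) \<le> norm (dual_operator T y') * norm x"
      using norm_blinfun[of "dual_operator T y'" x] y'(2) by simp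
    also have "\<dots> \<le> norm (dual_operator T) * norm x"
      using blinfun_apply_le_norm[OF y'(1), of "dual_operator T"] by (simp add: mult_right_mono)
    finally show "norm (T x) \<le> norm (dual_operator T) * norm x" .
  qed simp
qed

lemma norm_bidual_embedding: "norm (bidual_embedding x) = norm x"
proof (rule antisym)
  show "norm (bidual_embedding x) \<le> norm x"
  proof (rule norm_blinfun_bound)
    show "norm (bidual_embedding x f) \<le> norm x * norm f" for f :: "'a \<Rightarrow>\<^sub>L real"
      using norm_blinfun[of f x] by (simp add: mult.commute)
  qed simp
  obtain f :: "'a \<Rightarrow>\<^sub>L real" where "norm f \<le> 1" "f x = norm x"
    using norming_functional .
  then show "norm x \<le> norm (bidual_embedding x)"
    using blinfun_apply_le_norm[of f "bidual_embedding x"] by simp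
qed

lemma linear_bidual_embedding: "linear bidual_embedding"
  by (rule linearI) (auto intro!: blinfun_eqI simp: blinfun.bilinear_simps)


section \<open>Operators at which the norm is stably attained\<close>

text \<open>Plain quantifiers replace those over spheres, so that the condition can be transported
  along a surjection.\<close>

lemma A_norm_iff:
  "T \<in> A_norm \<longleftrightarrow> norm T = 1 \<and> (\<exists>x\<^sub>0. norm x\<^sub>0 = 1 \<and> norm (T x\<^sub>0) = 1) \<and>
    (\<forall>\<epsilon>>0. \<exists>\<eta>>0. \<forall>x. norm x = 1 \<longrightarrow> norm (T x) > 1 - \<eta> \<longrightarrow>
      (\<exists>x\<^sub>0. norm x\<^sub>0 = 1 \<and> norm (T x\<^sub>0) = 1 \<and> norm (x\<^sub>0 - x) < \<epsilon>))"
  by (cases "norm T = 1") (simp_all add: A_norm_def attains_norm_def Ball_def Bex_def)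

section \<open>Quantitative uniform smoothness and convexity\<close>

lemma uniformly_smooth_functionals:
  assumes "uniformly_smooth TYPE('a::real_normed_vector)" "0 < \<epsilon>"
  obtains \<delta> where "0 < \<delta>"
    "\<And>y (f :: 'a \<Rightarrow>\<^sub>L real) g. norm y = 1 \<Longrightarrow> norm f \<le> 1 \<Longrightarrow> norm g \<le> 1 \<Longrightarrow>
      blinfun_apply g y = 1 \<Longrightarrow> 1 - \<delta> < blinfun_apply f y \<Longrightarrow> norm (f - g) < \<epsilon>"
proof -
  have "0 < \<epsilon> / 2" using assms(2) by simp
  with assms(1) obtain t where t: "0 < t"
    and smooth: "\<And>y h :: 'a. norm y = 1 \<Longrightarrow> norm h \<le> t \<Longrightarrow> norm (y + h) + norm (y - h) \<le> 2 + \<epsilon> / 2 * norm h"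
    unfolding uniformly_smooth_def by (metis mem_sphere_0)
  show thesis
  proof (rule that[of "\<epsilon> * t / 4"])
    fix y :: 'a and f g :: "'a \<Rightarrow>\<^sub>L real"
    assume y: "norm y = 1" and f: "norm f \<le> 1" "1 - \<epsilon> * t / 4 < f y" and g: "norm g \<le> 1" "g y = 1"
    \<comment> \<open>Adding \<open>f (y + h) \<le> norm (y + h)\<close> and
      \<open>g (y - h) \<le> norm (y - h)\<close> bounds \<open>(f - g) h\<close> by half of
      \<open>\<epsilon> * t\<close> from smoothness plus a quarter from the defect of
      \<open>f\<close> at \<open>y\<close>. The total stays strictly below
      \<open>\<epsilon> * t\<close>.\<close>
    have bound: "(f - g) h \<le> 3 / 4 * \<epsilon> * t" if "norm h = t" for h
      using smooth[OF y, of h] functional_apply_le[OF f(1), of "y + h"]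
        functional_apply_le[OF g(1), of "y - h"] f(2) g(2) that
      by (simp add: blinfun.bilinear_simps)
    have "(f - g) h \<le> 3 / 4 * \<epsilon> * norm h" for h
    proof (cases "h = 0")
      case False
      then have "(t / norm h) * (f - g) h \<le> 3 / 4 * \<epsilon> * t"
        using bound[of "(t / norm h) *\<^sub>R h"] t by (simp add: blinfun.scaleR_right)
      then have "t * (f - g) h \<le> t * (3 / 4 * \<epsilon> * norm h)"
        using False by (simp add: field_simps)
      then show ?thesis using t by simp
    qed simp
    from this[of "- h" for h] this have "norm ((f - g) h) \<le> 3 / 4 * \<epsilon> * norm h" for h
      unfolding real_norm_def abs_le_iff by (simp add: blinfun.minus_right)
    then have "norm (f - g) \<le> 3 / 4 * \<epsilon>"
      using assms(2) by (intro norm_blinfun_bound) auto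
    with assms(2) show "norm (f - g) < \<epsilon>" by simp
  qed (use assms(2) t in simp)
qed

text \<open>The functional also exceeds \<open>1 - \<delta>\<close> at the midpoint, whose norm is
  therefore too large for points that are \<open>\<epsilon>\<close> apart.\<close>

lemma uniformly_convex_functional_near:
  assumes "uniformly_convex TYPE('a::real_normed_vector)" "0 < \<epsilon>"
  obtains \<delta> where "0 < \<delta>"
    "\<And>(f :: 'a \<Rightarrow>\<^sub>L real) x y. norm f \<le> 1 \<Longrightarrow> norm x = 1 \<Longrightarrow> norm y = 1 \<Longrightarrow> 1 - \<delta> < blinfun_apply f x \<Longrightarrow>
      1 - \<delta> < blinfun_apply f y \<Longrightarrow> norm (x - y) < \<epsilon>"
proof -
  from assms obtain \<delta> where \<delta>: "0 < \<delta>"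
    and conv: "\<And>x y :: 'a. norm x = 1 \<Longrightarrow> norm y = 1 \<Longrightarrow> \<epsilon> \<le> norm (x - y) \<Longrightarrow> norm ((x + y) /\<^sub>R 2) \<le> 1 - \<delta>"
    unfolding uniformly_convex_def by (metis mem_sphere_0)
  show thesis
  proof (rule that[OF \<delta>])
    fix f :: "'a \<Rightarrow>\<^sub>L real" and x y
    assume *: "norm f \<le> 1" "norm x = 1" "norm y = 1" "1 - \<delta> < f x" "1 - \<delta> < f y"
    have "1 - \<delta> < f ((x + y) /\<^sub>R 2)"
      using *(4,5) by (simp add: blinfun.bilinear_simps)
    also have "\<dots> \<le> norm ((x + y) /\<^sub>R 2)"
      by (rule functional_apply_le[OF *(1)])
    finally show "norm (x - y) < \<epsilon>"
      using conv[OF *(2,3)] by linarith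
  qed
qed

text \<open>A norming sequence is Cauchy by the preceding estimate, and its limit exists by
  completeness.\<close>

lemma uniformly_convex_functional_attains:
  fixes f :: "'a::banach \<Rightarrow>\<^sub>L real"
  assumes conv: "uniformly_convex TYPE('a)" and f: "norm f = 1"
  obtains x where "norm x = 1" "f x = 1"
proof -
  \<comment> \<open>With \<open>Suc n\<close> the level is 0 at \<open>n = 0\<close>, hence never
    negative, as \<open>functional_near_norm\<close> demands.\<close>
  have "\<exists>x. norm x = 1 \<and> 1 - inverse (real (Suc n)) < f x" for n
    using functional_near_norm[of "1 - inverse (real (Suc n))" f] f
    by (auto simp: inverse_le_1_iff)
  then obtain x where x: "\<And>n. norm (x n) = 1" "\<And>n. 1 - inverse (real (Suc n)) < f (x n)"
    by metis
  have lim1: "(\<lambda>n. 1 - inverse (real (Suc n))) \<longlonglongrightarrow> 1"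
    using tendsto_diff[OF tendsto_const[of 1] LIMSEQ_inverse_real_of_nat] by simp
  have "Cauchy x"
    unfolding Cauchy_def
  proof (intro allI impI)
    fix e :: real assume "0 < e"
    then obtain \<delta> where \<delta>: "0 < \<delta>"
      "\<And>u v. norm u = 1 \<Longrightarrow> norm v = 1 \<Longrightarrow> 1 - \<delta> < f u \<Longrightarrow> 1 - \<delta> < f v \<Longrightarrow> norm (u - v) < e"
      using uniformly_convex_functional_near[OF conv] f by (metis order_refl)
    obtain M where "\<And>n. n \<ge> M \<Longrightarrow> 1 - \<delta> < 1 - inverse (real (Suc n))"
      using order_tendstoD(1)[OF lim1, of "1 - \<delta>"] \<delta>(1) by (auto simp: eventually_sequentially)
    then have "1 - \<delta> < f (x n)" if "n \<ge> M" for n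
      using x(2)[of n] that by force
    then show "\<exists>M. \<forall>m\<ge>M. \<forall>n\<ge>M. dist (x m) (x n) < e"
      unfolding dist_norm using \<delta>(2) x(1) by blast
  qed
  then obtain l where l: "x \<longlonglongrightarrow> l"
    using Cauchy_convergent convergent_def by blast
  have nl: "norm l = 1"
    using tendsto_norm[OF l] x(1) by (simp add: LIMSEQ_const_iff)
  have "(\<lambda>n. f (x n)) \<longlonglongrightarrow> f l"
    by (intro tendsto_intros l)
  with lim1 have "1 \<le> f l"
    by (rule LIMSEQ_le) (use x(2) less_imp_le in blast)
  with functional_apply_le[of f l] f nl that show thesis by force
qed

section \<open>Norm attainment of adjoints over the reals\<close>

theorem uniformly_smooth_dual_operator_A_norm:
  fixes T :: "'a::real_normed_vector \<Rightarrow>\<^sub>L 'b::real_normed_vector"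
  assumes smooth: "uniformly_smooth TYPE('b)" and T: "T \<in> A_norm"
  shows "dual_operator T \<in> A_norm"
proof -
  have support: "\<exists>y'. norm y' = 1 \<and> blinfun_apply y' (T x) = 1 \<and> norm (dual_operator T y') = 1"
    if "norm x = 1" "norm (T x) = 1" for x
  proof -
    from that have "T x \<noteq> 0" by auto
    obtain y' :: "'b \<Rightarrow>\<^sub>L real" where y': "norm y' = 1" "y' (T x) = norm (T x)"
      using unit_norming_functional[OF \<open>T x \<noteq> 0\<close>] .
    have "norm (dual_operator T y') \<le> 1"
      using blinfun_apply_le_norm[of y' "dual_operator T"] y'(1) T
      by (simp add: norm_dual_operator A_norm_iff)
    moreover have "1 \<le> norm (dual_operator T y')"
      using blinfun_apply_le_norm[of x "dual_operator T y'"] y'(2) that by simp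
    ultimately show ?thesis using y' that(2) by auto
  qed
  show ?thesis
    unfolding A_norm_iff norm_dual_operator
  proof (intro conjI allI impI)
    show "norm T = 1" using T by (simp add: A_norm_iff)
    show "\<exists>y'. norm y' = 1 \<and> norm (dual_operator T y') = 1"
      using T support unfolding A_norm_iff by blast
    fix \<epsilon> :: real assume "0 < \<epsilon>"
    with smooth obtain \<delta> where \<delta>: "0 < \<delta>"
      "\<And>y (f :: 'b \<Rightarrow>\<^sub>L real) g. norm y = 1 \<Longrightarrow> norm f \<le> 1 \<Longrightarrow> norm g \<le> 1 \<Longrightarrow>
        blinfun_apply g y = 1 \<Longrightarrow> 1 - \<delta> < blinfun_apply f y \<Longrightarrow> norm (f - g) < \<epsilon>"
      by (rule uniformly_smooth_functionals) blast
    have "0 < \<delta> / 2" using \<delta>(1) by simp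
    with T obtain \<eta> where \<eta>: "0 < \<eta>" "\<And>x. norm x = 1 \<Longrightarrow> norm (T x) > 1 - \<eta> \<Longrightarrow>
        \<exists>x\<^sub>0. norm x\<^sub>0 = 1 \<and> norm (T x\<^sub>0) = 1 \<and> norm (x\<^sub>0 - x) < \<delta> / 2"
      unfolding A_norm_iff by metis
    \<comment> \<open>The threshold \<open>1 - c\<close> is the required one: 0 admits the choice of
      \<open>x\<close>, \<open>1 - \<eta>\<close> brings in the hypothesis on \<open>T\<close>, and
      \<open>1 - \<delta> / 2\<close> leaves half of \<open>\<delta>\<close> for replacing
      \<open>x\<close> by \<open>u\<close>.\<close>
    define c where "c = Max {0, 1 - \<eta>, 1 - \<delta> / 2}"
    have c: "0 \<le> c" "1 - \<eta> \<le> c" "1 - \<delta> / 2 \<le> c" "c < 1"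
      using \<eta>(1) \<delta>(1) by (auto simp: c_def)
    have "\<exists>z'. norm z' = 1 \<and> norm (dual_operator T z') = 1 \<and> norm (z' - y') < \<epsilon>"
      if y': "norm y' = 1" "1 - (1 - c) < norm (dual_operator T y')" for y'
    proof -
      have "c < norm (dual_operator T y')" using y'(2) by simp
      then obtain x where x: "norm x = 1" "c < y' (T x)"
        using c(1) functional_near_norm[of c "dual_operator T y'"] by auto
      have "y' (T x) \<le> norm (T x)"
        using functional_apply_le[of y'] y'(1) by simp
      with x c(2) \<eta>(2)[of x] obtain u where u: "norm u = 1" "norm (T u) = 1" "norm (u - x) < \<delta> / 2"
        by auto
      then obtain z' :: "'b \<Rightarrow>\<^sub>L real" where z': "norm z' = 1" "z' (T u) = 1" "norm (dual_operator T z') = 1"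
        using support by blast
      have "norm (dual_operator T y') \<le> 1"
        using blinfun_apply_le_norm[of y' "dual_operator T"] y'(1) T
        by (simp add: norm_dual_operator A_norm_iff)
      then have "y' (T (x - u)) \<le> norm (x - u)"
        using functional_apply_le[of "dual_operator T y'" "x - u"] by simp
      then have "1 - \<delta> < y' (T u)"
        using x(2) c(3) u(3) by (simp add: blinfun.bilinear_simps norm_minus_commute)
      then have "norm (z' - y') < \<epsilon>"
        using \<delta>(2)[of "T u" y' z'] u(2) y'(1) z' by (simp add: norm_minus_commute)
      with z' show ?thesis by blast
    qed
    with c(4) show "\<exists>\<eta>>0. \<forall>y'. norm y' = 1 \<longrightarrow> norm (dual_operator T y') > 1 - \<eta> \<longrightarrow>
        (\<exists>z'. norm z' = 1 \<and> norm (dual_operator T z') = 1 \<and> norm (z' - y') < \<epsilon>)"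
      by (intro exI[of _ "1 - c"]) auto
  qed
qed

theorem uniformly_convex_A_norm_of_dual_operator:
  fixes T :: "'a::banach \<Rightarrow>\<^sub>L 'b::real_normed_vector"
  assumes conv: "uniformly_convex TYPE('a)" and T: "dual_operator T \<in> A_norm"
  shows "T \<in> A_norm"
proof -
  have nT: "norm T = 1"
    using T by (simp add: A_norm_iff norm_dual_operator)
  \<comment> \<open>Where the adjoint image of \<open>y'\<close> takes the value 1, so does
    \<open>norm (T x)\<close>, squeezed between \<open>y' (T x)\<close> and
    \<open>norm T\<close>.\<close>
  have attain: "\<exists>x. norm x = 1 \<and> y' (T x) = 1 \<and> norm (T x) = 1"
    if y': "norm y' = 1" "norm (dual_operator T y') = 1" for y'
  proof -
    obtain x where x: "norm x = 1" "dual_operator T y' x = 1"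
      using uniformly_convex_functional_attains[OF conv y'(2)] .
    have "norm (T x) \<le> 1"
      using blinfun_apply_le_norm[of x T] x(1) nT by simp
    moreover have "1 \<le> norm (T x)"
      using functional_apply_le[of y' "T x"] x(2) y'(1) by simp
    ultimately show ?thesis using x by auto
  qed
  show ?thesis
    unfolding A_norm_iff
  proof (intro conjI allI impI nT)
    show "\<exists>x. norm x = 1 \<and> norm (T x) = 1"
      using T attain unfolding A_norm_iff by blast
    fix \<epsilon> :: real assume "0 < \<epsilon>"
    with conv obtain \<delta> where \<delta>: "0 < \<delta>"
      "\<And>(f :: 'a \<Rightarrow>\<^sub>L real) x y. norm f \<le> 1 \<Longrightarrow> norm x = 1 \<Longrightarrow> norm y = 1 \<Longrightarrow> 1 - \<delta> < blinfun_apply f x \<Longrightarrow>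
        1 - \<delta> < blinfun_apply f y \<Longrightarrow> norm (x - y) < \<epsilon>"
      by (rule uniformly_convex_functional_near) blast
    have "0 < \<delta> / 2" using \<delta>(1) by simp
    with T obtain \<eta> where \<eta>: "0 < \<eta>"
      "\<And>y'. norm y' = 1 \<Longrightarrow> norm (dual_operator T y') > 1 - \<eta> \<Longrightarrow>
        \<exists>z'. norm z' = 1 \<and> norm (dual_operator T z') = 1 \<and> norm (z' - y') < \<delta> / 2"
      unfolding A_norm_iff by metis
    \<comment> \<open>Here 0 ensures \<open>T x \<noteq> 0\<close>, and half of
      \<open>\<delta>\<close> is kept for replacing \<open>y'\<close> by \<open>z'\<close>.\<close>
    define c where "c = Max {0, 1 - \<eta>, 1 - \<delta> / 2}"
    have c: "0 \<le> c" "1 - \<eta> \<le> c" "1 - \<delta> / 2 \<le> c" "c < 1"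
      using \<eta>(1) \<delta>(1) by (auto simp: c_def)
    have "\<exists>u. norm u = 1 \<and> norm (T u) = 1 \<and> norm (u - x) < \<epsilon>"
      if x: "norm x = 1" "1 - (1 - c) < norm (T x)" for x
    proof -
      have "T x \<noteq> 0" using x(2) c(1) by auto
      obtain y' :: "'b \<Rightarrow>\<^sub>L real" where y': "norm y' = 1" "y' (T x) = norm (T x)"
        using unit_norming_functional[OF \<open>T x \<noteq> 0\<close>] .
      have "norm (T x) \<le> norm (dual_operator T y')"
        using blinfun_apply_le_norm[of x "dual_operator T y'"] x(1) y'(2) by simp
      then obtain z' where z': "norm z' = 1" "norm (dual_operator T z') = 1" "norm (z' - y') < \<delta> / 2"
        using \<eta>(2)[OF y'(1)] x(2) c(2) by auto
      obtain u where u: "norm u = 1" "z' (T u) = 1" "norm (T u) = 1"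
        using attain[OF z'(1,2)] by blast
      have "norm (T x) \<le> 1"
        using blinfun_apply_le_norm[of x T] x(1) nT by simp
      then have "norm ((y' - z') (T x)) \<le> norm (y' - z')"
        by (rule blinfun_apply_le_norm)
      then have "1 - \<delta> < dual_operator T z' x"
        using z'(3) y'(2) x(2) c(3) by (simp add: blinfun.bilinear_simps norm_minus_commute)
      then have "norm (u - x) < \<epsilon>"
        using \<delta>(2)[of "dual_operator T z'" u x] z'(2) u x(1) \<delta>(1) by simp
      with u show ?thesis by blast
    qed
    with c(4) show "\<exists>\<eta>>0. \<forall>x. norm x = 1 \<longrightarrow> norm (T x) > 1 - \<eta> \<longrightarrow>
        (\<exists>u. norm u = 1 \<and> norm (T u) = 1 \<and> norm (u - x) < \<epsilon>)"
      by (intro exI[of _ "1 - c"]) auto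
  qed
qed

text \<open>Membership depends only on the normed domain and on the function sending
  \<open>x\<close> to \<open>norm (F x)\<close>, so the codomains may differ. This allows the
  complex dual to be exchanged for the real one.\<close>

lemma A_norm_isometry_iff:
  fixes U :: "'a::real_normed_vector \<Rightarrow> 'c::real_normed_vector"
    and F :: "'a \<Rightarrow>\<^sub>L 'b::real_normed_vector" and G :: "'c \<Rightarrow>\<^sub>L 'd::real_normed_vector"
  assumes U: "linear U" "surj U" "\<And>x. norm (U x) = norm x" and GU: "\<And>x. norm (G (U x)) = norm (F x)"
  shows "F \<in> A_norm \<longleftrightarrow> G \<in> A_norm"
proof -
  have "norm F = norm G"
  proof (rule antisym; rule norm_blinfun_bound)
    show "norm (F x) \<le> norm G * norm x" for x
      using norm_blinfun[of G "U x"] by (simp add: U(3) GU)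
    show "norm (G y) \<le> norm F * norm y" for y
      using norm_blinfun[of F "inv U y"] U(3)[of "inv U y"] GU[of "inv U y"]
      by (simp add: surj_f_inv_f[OF U(2)])
  qed simp_all
  moreover have all: "(\<forall>y. P y) \<longleftrightarrow> (\<forall>x. P (U x))" and ex: "(\<exists>y. P y) \<longleftrightarrow> (\<exists>x. P (U x))" for P
    using U(2) by (metis surjD)+
  have diff: "norm (U x - U y) = norm (x - y)" for x y
    using U(3)[of "x - y"] linear_diff[OF U(1)] by simp
  ultimately show ?thesis
    unfolding A_norm_iff by (simp only: all ex) (simp add: U(3) GU diff)
qed


section \<open>Operators at which the numerical radius is stably attained\<close>

text \<open>Common form of the conditions defining \<^const>\<open>A_nu\<close> and \<^const>\<open>cA_nu\<close>, with \<open>P\<close> the set of states and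
  \<open>v\<close> the modulus of the numerical value.\<close>

definition stably_attains ::
    "('a::real_normed_vector \<times> 'b::real_normed_vector) set \<Rightarrow> ('a \<Rightarrow> 'b \<Rightarrow> real) \<Rightarrow> bool"
  where "stably_attains P v \<longleftrightarrow>
    (\<exists>(x, x')\<in>P. v x x' = (SUP (x, x')\<in>P. v x x')) \<and> (SUP (x, x')\<in>P. v x x') = 1 \<and>
    (\<forall>\<epsilon>>0. \<exists>\<eta>>0. \<forall>(x, x')\<in>P. v x x' > 1 - \<eta> \<longrightarrow>
      (\<exists>(x\<^sub>0, x\<^sub>0')\<in>P. v x\<^sub>0 x\<^sub>0' = 1 \<and> norm (x\<^sub>0 - x) < \<epsilon> \<and> norm (x\<^sub>0' - x') < \<epsilon>))"

lemma A_nu_iff: "T \<in> A_nu \<longleftrightarrow> stably_attains states (\<lambda>x x'. norm (blinfun_apply x' (T x)))"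
  by (simp add: A_nu_def stably_attains_def attains_numerical_radius_def numerical_radius_def)

lemma cA_nu_iff: "T \<in> cA_nu \<longleftrightarrow> stably_attains cstates (\<lambda>x x'. norm (cblinfun_apply x' (T x)))"
  by (simp add: cA_nu_def stably_attains_def cattains_numerical_radius_def cnumerical_radius_def)

text \<open>The image form of \<open>Q\<close> carries all the surjectivity that is used. The values
  agree, and the two closeness conditions trade places because \<open>J\<close> is
  isometric.\<close>

lemma stably_attains_swap:
  assumes J: "linear J" "\<And>x. norm (J x) = norm x"
    and Q: "Q = (\<lambda>(x, x'). (x', J x)) ` P" and w: "\<And>x x'. w x' (J x) = v x x'"
  shows "stably_attains P v \<longleftrightarrow> stably_attains Q w"
proof -
  have diff: "norm (J x - J y) = norm (x - y)" for x y
    using J(2)[of "x - y"] linear_diff[OF J(1)] by simp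
  have "(SUP (y, y')\<in>Q. w y y') = (SUP (x, x')\<in>P. v x x')"
    unfolding Q by (simp add: image_image case_prod_unfold w)
  moreover have "(\<exists>(y, y')\<in>Q. R y y') \<longleftrightarrow> (\<exists>(x, x')\<in>P. R x' (J x))"
    and "(\<forall>(y, y')\<in>Q. R y y') \<longleftrightarrow> (\<forall>(x, x')\<in>P. R x' (J x))" for R
    unfolding Q by (simp_all add: case_prod_unfold)
  ultimately show ?thesis
    unfolding stably_attains_def by (simp only: w diff conj_ac)
qed

theorem reflexive_A_nu_dual_operator:
  fixes S :: "'a::real_normed_vector \<Rightarrow>\<^sub>L 'a"
  assumes "reflexive_space TYPE('a)"
  shows "S \<in> A_nu \<longleftrightarrow> dual_operator S \<in> A_nu"
  unfolding A_nu_iff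
proof (rule stably_attains_swap[OF linear_bidual_embedding norm_bidual_embedding])
  have surj: "\<exists>x. x'' = bidual_embedding x" for x'' :: "('a \<Rightarrow>\<^sub>L real) \<Rightarrow>\<^sub>L real"
    using assms unfolding reflexive_space_def by (rule surjD)
  \<comment> \<open>By reflexivity \<open>x''\<close> is evaluation at some \<open>x\<close>, and
    the requirements on \<open>(x', x'')\<close> become those on \<open>(x, x')\<close>.\<close>
  have "(x', x'') \<in> states \<longleftrightarrow> (\<exists>x. (x, x') \<in> states \<and> x'' = bidual_embedding x)"
    for x' :: "'a \<Rightarrow>\<^sub>L real" and x''
    using surj[of x''] by (auto simp: states_def norm_bidual_embedding)
  then show "states = (\<lambda>(x, x'). (x', bidual_embedding x)) ` (states :: ('a \<times> _) set)"
    by (force simp: image_iff)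
qed simp


section \<open>Complex scalars\<close>

lemma cblinfun_eqI: "(\<And>x. cblinfun_apply f x = cblinfun_apply g x) \<Longrightarrow> f = g"
  by transfer auto

lemma cdual_operator_apply [simp]: "cdual_operator T y' x = y' (T x)"
  by transfer (simp add: cblinfun_compose.rep_eq)

lemma cbidual_embedding_apply [simp]: "cbidual_embedding x x' = x' x"
  by transfer simp

lemma cblinfun_add_apply [simp]: "cblinfun_apply (f + g) x = f x + g x"
  by transfer simp

lemma cblinfun_scaleC_apply [simp]: "cblinfun_apply (c *\<^sub>C f) x = c *\<^sub>C f x"
  by transfer simp

lemma bounded_clinear_cblinfun_apply: "bounded_clinear (cblinfun_apply f)"
  using cblinfun_apply by auto

lemma cblinfun_apply_scaleC: "cblinfun_apply f (c *\<^sub>C x) = c *\<^sub>C f x"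
  using bounded_clinear_cblinfun_apply[of f] by (simp add: bounded_clinear_def)

lemma cblinfun_apply_add: "cblinfun_apply f (x + y) = f x + f y"
  using bounded_clinear_cblinfun_apply[of f] by (simp add: bounded_clinear_def)

section \<open>Passage to the underlying real spaces\<close>

lift_definition blinfun_of :: "('a::complex_normed_vector \<Rightarrow>\<^sub>C\<^sub>L 'b::complex_normed_vector) \<Rightarrow> ('a \<Rightarrow>\<^sub>L 'b)"
  is "\<lambda>f. f"
  by (rule bounded_clinear_imp_bounded_linear)

lemma blinfun_of_apply [simp]: "blinfun_of f x = cblinfun_apply f x"
  by transfer simp

lemma norm_blinfun_of: "norm (blinfun_of f) = norm f"
  by transfer simp

lemma cA_norm_iff: "T \<in> cA_norm \<longleftrightarrow> blinfun_of T \<in> A_norm"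
  by (simp add: cA_norm_def A_norm_def cattains_norm_def attains_norm_def norm_blinfun_of)

lift_definition Re_functional :: "('a::complex_normed_vector \<Rightarrow>\<^sub>C\<^sub>L complex) \<Rightarrow> ('a \<Rightarrow>\<^sub>L real)"
  is "\<lambda>f x. Re (f x)"
  by (intro bounded_linear_compose[OF bounded_linear_Re] bounded_clinear_imp_bounded_linear)

lemma Re_functional_apply [simp]: "Re_functional f x = Re (cblinfun_apply f x)"
  by transfer simp

lemma linear_Re_functional: "linear Re_functional"
  by (rule linearI)
    (auto intro!: blinfun_eqI simp: blinfun.bilinear_simps scaleR_scaleC scaleC_complex_def)

text \<open>Rotating \<open>x\<close> by a unit scalar makes \<open>f x\<close> real.\<close>

lemma cmod_apply_le_Re_functional:
  fixes f :: "'a::complex_normed_vector \<Rightarrow>\<^sub>C\<^sub>L complex"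
  shows "cmod (f x) \<le> norm (Re_functional f) * norm x"
proof (cases "f x = 0")
  case False
  define c where "c = cnj (sgn (cblinfun_apply f x))"
  have c: "cmod c = 1" using False by (simp add: c_def norm_sgn)
  have "f (c *\<^sub>C x) = c * f x" by (simp add: cblinfun_apply_scaleC scaleC_complex_def)
  also have "\<dots> = cmod (f x)"
    using False
    by (simp add: c_def sgn_div_norm scaleR_conv_of_real complex_norm_square[symmetric]
        mult.commute[of "cnj _"] field_simps power2_eq_square)
  finally have "Re_functional f (c *\<^sub>C x) = cmod (f x)" by simp
  then show ?thesis
    using norm_blinfun[of "Re_functional f" "c *\<^sub>C x"] c by (simp add: norm_scaleC)
qed simp

lemma norm_Re_functional: "norm (Re_functional f) = norm f"
proof (rule antisym)
  show "norm (Re_functional f) \<le> norm f"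
    using norm_cblinfun[of f] abs_Re_le_cmod order_trans
    by (intro norm_blinfun_bound) (auto, blast)
  show "norm f \<le> norm (Re_functional f)"
    by (intro norm_cblinfun_bound cmod_apply_le_Re_functional) simp
qed

text \<open>A real functional \<open>u\<close> is the real part of the complex-linear functional
  with value \<open>u x - \<i> * u (\<i> *\<^sub>C x)\<close> at \<open>x\<close>.\<close>

lemma surj_Re_functional: "surj (Re_functional :: ('a::complex_normed_vector \<Rightarrow>\<^sub>C\<^sub>L complex) \<Rightarrow> _)"
proof (rule surjI)
  fix u :: "'a \<Rightarrow>\<^sub>L real"
  define f where "f x = Complex (u x) (- u (\<i> *\<^sub>C x))" for x
  have "f (c *\<^sub>C x) = c *\<^sub>C f x" for c x
  proof -
    \<comment> \<open>Complex homogeneity reduces to real linearity; the scalars \<open>c\<close>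
      and \<open>\<i> * c\<close> yield the real and imaginary parts.\<close>
    have split: "u (d *\<^sub>C y) = Re d * u y + Im d * u (\<i> *\<^sub>C y)" for d and y :: 'a
    proof -
      have "d *\<^sub>C y = Re d *\<^sub>R y + Im d *\<^sub>R (\<i> *\<^sub>C y)"
        unfolding scaleR_scaleC scaleC_scaleC scaleC_add_left[symmetric]
        by (rule arg_cong[where f = "\<lambda>c. c *\<^sub>C y"]) (simp add: complex_eq_iff)
      then show ?thesis by (simp add: blinfun.bilinear_simps)
    qed
    show ?thesis
      using split[of c x] split[of "\<i> * c" x]
      by (simp add: f_def scaleC_scaleC scaleC_complex_def complex_eq_iff algebra_simps)
  qed
  moreover have "f (x + y) = f x + f y" for x y
    by (simp add: f_def blinfun.bilinear_simps scaleC_add_right complex_eq_iff)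
  \<comment> \<open>Any bound will do here; the exact norm comes from
    \<open>norm_Re_functional\<close>.\<close>
  moreover have "norm (f x) \<le> norm x * (2 * norm u)" for x
    using cmod_le[of "f x"] norm_blinfun[of u x] norm_blinfun[of u "\<i> *\<^sub>C x"]
    by (simp add: f_def norm_scaleC mult_ac)
  ultimately have "bounded_clinear f"
    unfolding bounded_clinear_def by blast
  then show "Re_functional (CBlinfun (\<lambda>x. Complex (u x) (- u (\<i> *\<^sub>C x)))) = u"
    by (intro blinfun_eqI) (simp add: CBlinfun_inverse f_def[abs_def])
qed

text \<open>Taking real parts commutes with forming adjoints, and it is an isometry of the duals of
  both spaces.\<close>

lemma cdual_operator_A_norm_iff:
  "cdual_operator T \<in> cA_norm \<longleftrightarrow> dual_operator (blinfun_of T) \<in> A_norm"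
  unfolding cA_norm_iff
proof (rule A_norm_isometry_iff[OF linear_Re_functional surj_Re_functional norm_Re_functional])
  fix y'
  have "dual_operator (blinfun_of T) (Re_functional y') = Re_functional (cdual_operator T y')"
    by (rule blinfun_eqI) simp
  then show "norm (dual_operator (blinfun_of T) (Re_functional y')) = norm (blinfun_of (cdual_operator T) y')"
    by (simp add: norm_Re_functional)
qed

section \<open>The complex bidual and the numerical radius\<close>

lemma norm_cbidual_embedding: "norm (cbidual_embedding x) = norm x"
proof (rule antisym)
  show "norm (cbidual_embedding x) \<le> norm x"
    by (rule norm_cblinfun_bound) (use norm_cblinfun[of _ x] in \<open>auto simp: mult.commute\<close>)
  obtain u :: "'a \<Rightarrow>\<^sub>L real" where u: "norm u \<le> 1" "u x = norm x"
    using norming_functional .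
  \<comment> \<open>Lifting the real norming functional amounts to the complex Hahn-Banach
    theorem.\<close>
  obtain f where f: "u = Re_functional f"
    using surj_Re_functional by (rule surjE)
  have "norm x \<le> cmod (f x)"
    using u(2) complex_Re_le_cmod[of "f x"] by (simp add: f)
  also have "\<dots> \<le> norm (cbidual_embedding x) * norm f"
    using norm_cblinfun[of "cbidual_embedding x" f] by simp
  also have "\<dots> \<le> norm (cbidual_embedding x) * 1"
    using u(1) by (intro mult_left_mono) (simp_all add: f norm_Re_functional)
  finally show "norm x \<le> norm (cbidual_embedding x)" by simp
qed

lemma linear_cbidual_embedding: "linear cbidual_embedding"
  by (rule linearI) (auto intro!: cblinfun_eqI simp: cblinfun_apply_add cblinfun_apply_scaleC scaleR_scaleC)

theorem creflexive_cA_nu_cdual_operator: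
  fixes S :: "'a::complex_normed_vector \<Rightarrow>\<^sub>C\<^sub>L 'a"
  assumes "creflexive_space TYPE('a)"
  shows "S \<in> cA_nu \<longleftrightarrow> cdual_operator S \<in> cA_nu"
  unfolding cA_nu_iff
proof (rule stably_attains_swap[OF linear_cbidual_embedding norm_cbidual_embedding])
  have surj: "\<exists>x. x'' = cbidual_embedding x" for x'' :: "('a \<Rightarrow>\<^sub>C\<^sub>L complex) \<Rightarrow>\<^sub>C\<^sub>L complex"
    using assms unfolding creflexive_space_def by (rule surjD)
  have "(x', x'') \<in> cstates \<longleftrightarrow> (\<exists>x. (x, x') \<in> cstates \<and> x'' = cbidual_embedding x)"
    for x' :: "'a \<Rightarrow>\<^sub>C\<^sub>L complex" and x''
    using surj[of x''] by (auto simp: cstates_def norm_cbidual_embedding)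
  then show "cstates = (\<lambda>(x, x'). (x', cbidual_embedding x)) ` (cstates :: ('a \<times> _) set)"
    by (force simp: image_iff)
qed simp


theorem proposition2p9:
  fixes T :: "'a::banach \<Rightarrow>\<^sub>L 'b::banach"
    and S :: "'a \<Rightarrow>\<^sub>L 'a"
    and Tc :: "'c::complex_banach \<Rightarrow>\<^sub>C\<^sub>L 'd::complex_banach"
    and Sc :: "'c \<Rightarrow>\<^sub>C\<^sub>L 'c"
  shows
    "((uniformly_smooth TYPE('b) \<longrightarrow> T \<in> A_norm \<longrightarrow> dual_operator T \<in> A_norm) \<and>
      (uniformly_convex TYPE('a) \<longrightarrow> dual_operator T \<in> A_norm \<longrightarrow> T \<in> A_norm) \<and>
      (reflexive_space TYPE('a) \<longrightarrow> (S \<in> A_nu \<longleftrightarrow> dual_operator S \<in> A_nu))) \<and>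
     ((uniformly_smooth TYPE('d) \<longrightarrow> Tc \<in> cA_norm \<longrightarrow> cdual_operator Tc \<in> cA_norm) \<and>
      (uniformly_convex TYPE('c) \<longrightarrow> cdual_operator Tc \<in> cA_norm \<longrightarrow> Tc \<in> cA_norm) \<and>
      (creflexive_space TYPE('c) \<longrightarrow> (Sc \<in> cA_nu \<longleftrightarrow> cdual_operator Sc \<in> cA_nu)))"
  \<comment> \<open>The order matters: unfolding \<open>cA_norm_iff\<close> first would also rewrite
    the adjoint's membership and hide it from the other rule. Uniform smoothness and convexity
    concern only the real structure, so the real theorems then apply.\<close>
  unfolding cdual_operator_A_norm_iff unfolding cA_norm_iff
  by (intro conjI impI reflexive_A_nu_dual_operator creflexive_cA_nu_cdual_operator;
    (assumption | erule (1) uniformly_smooth_dual_operator_A_norm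
      | erule (1) uniformly_convex_A_norm_of_dual_operator))

end
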